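(* Assume that $\Omega$ is nonempty and compact and that $q_i(x)>0$ for all $x\in\Omega$ and all $i=1,\dots,m$. Then for any $d>0$ there exists a number $\delta(d)>0$, depending on $d$, such that for every $\epsilon=(\epsilon_1,\dots,\epsilon_m)\in\mathbb{R}^m_+$ with $\max_{i}\epsilon_i<\delta(d)$ one has $\mathrm{dist}(u,\mathcal{S}_w)<d$ for every $u\in\mathcal{S}_w^{\epsilon}$; that is, $\mathcal{S}_w^{\epsilon}\subset \mathcal{S}_w+d\mathbf{B}$.
   Context: Let $n,m,r\ge 1$, let $p_1,\dots,p_m,q_1,\dots,q_m,g_1,\dots,g_r\in\mathbb{R}[x]$ be real polynomials in $x=(x_1,\dots,x_n)$, let $\Omega=\{x\in\mathbb{R}^n: g_j(x)\ge 0,\ j=1,\dots,r\}$, and let $f=(f_1,\dots,f_m)$ with $f_i=p_i/q_i$. Consider the vector optimization problem of minimizing $f$ over $\Omega$ with respect to the ordering cone $\mathbb{R}^m_+$ (the nonnegative orthant); $\mathbb{R}^m_{++}$ is the open positive orthant. A point $x\in\Omega$ is weakly efficient if $f(y)-f(x)\notin-\mathbb{R}^m_{++}$ for all $y\in\Omega$; $\mathcal{S}_w$ is the set of all weakly efficient points. For $\epsilon\in\mathbb{R}^m_+$, a point $x\in\Omega$ is weakly $\epsilon$-efficient if $f(y)-f(x)+\epsilon\notin-\mathbb{R}^m_{++}$ for all $y\in\Omega$; $\mathcal{S}_w^{\epsilon}$ is the set of all such points. $\mathrm{dist}(u,D)$ is the Euclidean distance from $u$ to $D$, and $\mathbf{B}$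 is the closed Euclidean unit ball of $\mathbb{R}^n$ centered at the origin. *)

theory Defs
  imports "HOL-Analysis.Analysis"
begin

definition nonneg_orthant :: "(real ^ 'm) set" where
  "nonneg_orthant = {v. \<forall>i. 0 \<le> v $ i}"

definition pos_orthant :: "(real ^ 'm) set" where
  "pos_orthant = {v. \<forall>i. 0 < v $ i}"

definition feasible_set :: "('r \<Rightarrow> real ^ 'n \<Rightarrow> real) \<Rightarrow> (real ^ 'n) set" where
  "feasible_set g = {x. \<forall>j. g j x \<ge> 0}"

(* Division is total in HOL, so this is a function on the whole space; only its values
   where all denominators are nonzero are meaningful. *)
definition rational_map ::
    "('m \<Rightarrow> real ^ 'n \<Rightarrow> real) \<Rightarrow> ('m \<Rightarrow> real ^ 'n \<Rightarrow> real) \<Rightarrow> real ^ 'n \<Rightarrow> real ^ 'm" where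
  "rational_map p q x = (\<chi> i. p i x / q i x)"

definition weakly_efficient_set ::
    "(real ^ 'n \<Rightarrow> real ^ 'm) \<Rightarrow> (real ^ 'n) set \<Rightarrow> (real ^ 'n) set" where
  "weakly_efficient_set f \<Omega> =
     {x \<in> \<Omega>. \<forall>y\<in>\<Omega>. f y - f x \<notin> uminus ` pos_orthant}"

definition weakly_eps_efficient_set ::
    "(real ^ 'n \<Rightarrow> real ^ 'm) \<Rightarrow> (real ^ 'n) set \<Rightarrow> real ^ 'm \<Rightarrow> (real ^ 'n) set" where
  "weakly_eps_efficient_set f \<Omega> \<epsilon> =
     {x \<in> \<Omega>. \<forall>y\<in>\<Omega>. f y - f x + \<epsilon> \<notin> uminus ` pos_orthant}"

(* Pitfall: infdist u {} = 0, whereas the usual convention is dist(u, {}) = \<infinity>.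
   A bound infdist u D < d should therefore be accompanied by a condition that
   forces D to be nonempty, such as u \<in> D + d B with B the closed unit ball. *)

end

theory Submission
  imports Defs
begin

text \<open>
  The points of the feasible set at distance at least \<open>d\<close> from every weakly efficient point form
  a compact set \<open>K\<close>. Each of them is strictly dominated by some feasible point, and by continuity
  strict domination with a given gap persists nearby, so the gap can be chosen uniformly on \<open>K\<close>.
  If the entries of \<open>\<epsilon>\<close> lie below this gap, then no point of \<open>K\<close> is weakly \<open>\<epsilon>\<close>-efficient. The
  argument does not presuppose that weakly efficient points exist.
\<close>

lemma in_uminus_pos_orthant_iff: "v \<in> uminus ` pos_orthant \<longleftrightarrow> (\<forall>i. v $ i < 0)"
proof -
  have "v \<in> uminus ` pos_orthant \<longleftrightarrow> - v \<in> pos_orthant"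
    by (metis (no_types, lifting) add.inverse_inverse image_iff)
  then show ?thesis
    by (simp add: pos_orthant_def)
qed

text \<open>Sequential compactness: if every gap failed somewhere on \<open>K\<close>, the points of
  failure would accumulate at some \<open>l\<close> in \<open>K\<close>. A single \<open>y\<close>
  that strictly dominates \<open>l\<close> then dominates nearby points of failure by more than the
  vanishing gap, a contradiction.\<close>

lemma uniform_domination_gap:
  fixes f :: "'a::metric_space \<Rightarrow> real ^ 'm::finite"
  assumes K: "compact K" and cont: "continuous_on K f"
    and dom: "\<And>u. u \<in> K \<Longrightarrow> \<exists>y\<in>Y. \<forall>i. f y $ i < f u $ i"
  shows "\<exists>\<delta>>0. \<forall>u\<in>K. \<exists>y\<in>Y. \<forall>i. f y $ i + \<delta> < f u $ i"
proof (rule ccontr)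
  assume neg: "\<not> ?thesis"
  \<comment> \<open>The failing gaps tend to 0; \<open>Suc n\<close> keeps the gap positive at
    \<open>n = 0\<close> as well.\<close>
  have "\<exists>u\<in>K. \<forall>y\<in>Y. \<exists>i. f u $ i \<le> f y $ i + 1 / real (Suc n)" for n
    using neg by (metis not_less of_nat_0_less_iff zero_less_Suc zero_less_divide_1_iff)
  then obtain u where uK: "\<And>n. u n \<in> K"
    and u: "\<And>n y. y \<in> Y \<Longrightarrow> \<exists>i. f (u n) $ i \<le> f y $ i + 1 / real (Suc n)"
    by metis
  obtain l r where l: "l \<in> K" and r: "strict_mono r" and lim: "(u \<circ> r) \<longlonglongrightarrow> l"
    using K uK unfolding compact_def by blast
  obtain y where y: "y \<in> Y" "\<And>i. f y $ i < f l $ i"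
    using dom[OF l] by blast
  have flim: "(\<lambda>n. f (u (r n))) \<longlonglongrightarrow> f l"
    using continuous_on_tendsto_compose[OF cont lim l] uK by (simp add: o_def)
  have gap0: "(\<lambda>n. 1 / real (Suc (r n))) \<longlonglongrightarrow> 0"
    using LIMSEQ_subseq_LIMSEQ[OF lim_inverse_n' [THEN LIMSEQ_Suc] r] by (simp add: o_def)
  have "\<forall>\<^sub>F n in sequentially. f y $ i + 1 / real (Suc (r n)) < f (u (r n)) $ i" for i
  proof -
    \<comment> \<open>With the gap moved to the side of \<open>f (u (r n))\<close>, the other side
      is the constant \<open>f y $ i\<close>, which lies strictly below the limit.\<close>
    have "(\<lambda>n. f (u (r n)) $ i - 1 / real (Suc (r n))) \<longlonglongrightarrow> f l $ i - 0"
      by (intro tendsto_diff tendsto_vec_nth flim gap0)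
    then have "\<forall>\<^sub>F n in sequentially. f y $ i < f (u (r n)) $ i - 1 / real (Suc (r n))"
      using y(2)[of i] by (intro order_tendstoD(1)) auto
    then show ?thesis
      by (rule eventually_mono) linarith
  qed
  \<comment> \<open>There are finitely many coordinates, so one threshold serves them all.\<close>
  then have "\<forall>\<^sub>F n in sequentially. \<forall>i. f y $ i + 1 / real (Suc (r n)) < f (u (r n)) $ i"
    by (simp add: eventually_all_finite)
  then obtain n where "\<And>i. f y $ i + 1 / real (Suc (r n)) < f (u (r n)) $ i"
    using eventually_happens'[OF sequentially_bot] by blast
  then show False
    using u[OF y(1), of "r n"] by (meson not_le)
qed

text \<open>Closeness is expressed by an actual point \<open>s\<close>, which excludes the
  degenerate value of \<open>infdist\<close> at the empty set and yields both the distance bound and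
  the inclusion.\<close>

lemma weakly_eps_efficient_near_weakly_efficient:
  fixes f :: "real ^ 'n \<Rightarrow> real ^ 'm::finite"
  assumes \<Omega>: "compact \<Omega>" and cont: "continuous_on \<Omega> f" and d: "d > 0"
  shows "\<exists>\<delta>>0. \<forall>\<epsilon>. (\<forall>i. \<epsilon> $ i < \<delta>) \<longrightarrow>
           (\<forall>u\<in>weakly_eps_efficient_set f \<Omega> \<epsilon>. \<exists>s\<in>weakly_efficient_set f \<Omega>. dist s u < d)"
proof -
  define S where "S = weakly_efficient_set f \<Omega>"
  \<comment> \<open>Open balls are removed, so \<open>K\<close> stays compact; without weakly
    efficient points \<open>K\<close> would be all of \<open>\<Omega>\<close>.\<close>
  define K where "K = \<Omega> - (\<Union>s\<in>S. ball s d)"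
  have "compact K"
    unfolding K_def using \<Omega> by (intro compact_diff open_UN) auto
  moreover have "continuous_on K f"
    using cont by (rule continuous_on_subset) (auto simp: K_def)
  moreover have "\<exists>y\<in>\<Omega>. \<forall>i. f y $ i < f u $ i" if "u \<in> K" for u
  proof -
    \<comment> \<open>A point of \<open>S\<close> lies in its own ball, since \<open>d > 0\<close>,
      and so is not in \<open>K\<close>.\<close>
    have "u \<in> \<Omega>" "u \<notin> S"
      using that d by (auto simp: K_def)
    then show ?thesis
      by (auto simp: S_def weakly_efficient_set_def in_uminus_pos_orthant_iff)
  qed
  ultimately obtain \<delta> where \<delta>: "\<delta> > 0"
    and gap: "\<And>u. u \<in> K \<Longrightarrow> \<exists>y\<in>\<Omega>. \<forall>i. f y $ i + \<delta> < f u $ i"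
    using uniform_domination_gap[of K f \<Omega>] by blast
  have "\<exists>s\<in>S. dist s u < d"
    if \<epsilon>: "\<And>i. \<epsilon> $ i < \<delta>" and u: "u \<in> weakly_eps_efficient_set f \<Omega> \<epsilon>" for \<epsilon> u
  proof (rule ccontr)
    assume far: "\<not> ?thesis"
    have "u \<in> K"
      using u far by (auto simp: K_def weakly_eps_efficient_set_def)
    then obtain y where y: "y \<in> \<Omega>" and less: "\<And>i. f y $ i + \<delta> < f u $ i"
      using gap by blast
    \<comment> \<open>The perturbation \<open>\<epsilon> $ i\<close> is smaller than the domination
      gap, so it cannot undo the domination of \<open>u\<close> by \<open>y\<close>.\<close>
    have "(f y - f u + \<epsilon>) $ i < 0" for i
      using less[of i] \<epsilon>[of i] by simp
    then show False
      using u y by (auto simp: weakly_eps_efficient_set_def in_uminus_pos_orthant_iff)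
  qed
  then show ?thesis
    using \<delta> unfolding S_def by blast
qed

lemma continuous_on_rational_map:
  fixes p q :: "'m::finite \<Rightarrow> real ^ 'n \<Rightarrow> real"
  assumes "\<And>i. real_polynomial_function (p i)" "\<And>i. real_polynomial_function (q i)"
    and "\<And>x i. x \<in> S \<Longrightarrow> q i x \<noteq> 0"
  shows "continuous_on S (rational_map p q)"
proof -
  have "continuous_on S (\<lambda>x. \<chi> i. p i x / q i x)"
    using assms by (intro continuous_on_vec_lambda continuous_on_divide
        continuous_on_polymonial_function) (auto simp: real_polynomial_function_eq)
  then show ?thesis
    by (simp add: rational_map_def[abs_def])
qed

theorem proposition3p2:
  fixes p q :: "'m::finite \<Rightarrow> real ^ 'n \<Rightarrow> real"
    and g :: "'r::finite \<Rightarrow> real ^ 'n \<Rightarrow> real"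
    and \<Omega> :: "(real ^ 'n) set"
    and f :: "real ^ 'n \<Rightarrow> real ^ 'm"
  assumes "\<And>i. real_polynomial_function (p i)"
    and "\<And>i. real_polynomial_function (q i)"
    and "\<And>j. real_polynomial_function (g j)"
    and "\<Omega> = feasible_set g"
    and "f = rational_map p q"
    and "\<Omega> \<noteq> {}"
    and "compact \<Omega>"
    and "\<And>x i. x \<in> \<Omega> \<Longrightarrow> q i x > 0"
  shows "\<forall>d>0. \<exists>\<delta>>0. \<forall>\<epsilon>\<in>nonneg_orthant. (MAX i. \<epsilon> $ i) < \<delta> \<longrightarrow>
           (\<forall>u\<in>weakly_eps_efficient_set f \<Omega> \<epsilon>. infdist u (weakly_efficient_set f \<Omega>) < d) \<and>
           weakly_eps_efficient_set f \<Omega> \<epsilon>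
             \<subseteq> weakly_efficient_set f \<Omega> + ((*\<^sub>R) d ` cball 0 1)"
proof (intro allI impI)
  fix d :: real assume d: "d > 0"
  let ?S = "weakly_efficient_set f \<Omega>"
  have "continuous_on \<Omega> f"
    unfolding \<open>f = rational_map p q\<close> using assms(1,2,8)
    by (intro continuous_on_rational_map) (auto simp: less_imp_neq[symmetric])
  then obtain \<delta> where \<delta>: "\<delta> > 0"
    and near: "\<And>\<epsilon> u. (\<And>i. \<epsilon> $ i < \<delta>) \<Longrightarrow> u \<in> weakly_eps_efficient_set f \<Omega> \<epsilon> \<Longrightarrow>
                 \<exists>s\<in>?S. dist s u < d"
    using weakly_eps_efficient_near_weakly_efficient[OF \<open>compact \<Omega>\<close> _ d] by blast
  have "infdist u ?S < d \<and> u \<in> ?S + ((*\<^sub>R) d ` cball 0 1)"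
    if "(MAX i. \<epsilon> $ i) < \<delta>" and u: "u \<in> weakly_eps_efficient_set f \<Omega> \<epsilon>" for \<epsilon> u
  proof -
    have "\<epsilon> $ i < \<delta>" for i
      using that(1) by simp
    then obtain s where s: "s \<in> ?S" "dist s u < d"
      using near u by blast
    have "infdist u ?S \<le> dist u s"
      using s(1) by (rule infdist_le)
    then have "infdist u ?S < d"
      using s(2) by (simp add: dist_commute)
    \<comment> \<open>The same \<open>s\<close> gives the decomposition
      \<open>u = s + (u - s)\<close>, whose second summand has norm below \<open>d\<close>.\<close>
    moreover have "u - s \<in> (*\<^sub>R) d ` cball 0 1"
      using s(2) d by (simp add: cball_scale dist_norm norm_minus_commute)
    with s(1) have "s + (u - s) \<in> ?S + ((*\<^sub>R) d ` cball 0 1)"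
      by (rule set_plus_intro)
    ultimately show ?thesis
      by simp
  qed
  then show "\<exists>\<delta>>0. \<forall>\<epsilon>\<in>nonneg_orthant. (MAX i. \<epsilon> $ i) < \<delta> \<longrightarrow>
      (\<forall>u\<in>weakly_eps_efficient_set f \<Omega> \<epsilon>. infdist u ?S < d) \<and>
      weakly_eps_efficient_set f \<Omega> \<epsilon> \<subseteq> ?S + ((*\<^sub>R) d ` cball 0 1)"
    using \<delta> by blast
qed

end
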